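(* Let $\mathcal{S}$ be a nonempty set with a scene space basis $\mathcal{B}$. Let $P,Q$ be programs over $\mathcal{S}$ and $F_P,F_Q:\mathcal{S}\to\{\text{true},\text{false}\}$ formulas such that $P$ does not interfere with $F_Q$ and $Q$ does not interfere with $F_P$. Then $[P]F_P\land[Q]F_Q\implies [P\parallel Q](F_P\land F_Q)$; that is, for every state $s\in\mathcal{S}$, if $([P]F_P)(s)$ and $([Q]F_Q)(s)$ hold then $([P\parallel Q](F_P\land F_Q))(s)$ holds.
   Context: Scenes. Let $\mathcal{S}$ be a nonempty set (of states). A scene on $\mathcal{S}$ is a function $A:\mathcal{S}\to\mathcal{S}\to\mathcal{S}$, also written $\mathrm{mrg}_A$, satisfying for all $x,y,z$: $A\,(A\,x\,y)\,z = A\,x\,z$, $A\,x\,(A\,y\,z)=A\,x\,z$, $A\,x\,x=x$. Write $\bot = (\lambda s_1\,s_2.\ s_1)$, $\top=(\lambda s_1\,s_2.\ s_2)$, $A^{\complement}=(\lambda s_1\,s_2.\ A\,s_2\,s_1)$, $A\sqcup B=(\lambda s_1\,s_2.\ B\,(A\,s_1\,s_2)\,s_2)$. Scenes $A,B$ are independent if $B\,(A\,s_1\,s_2)\,s_3=A\,(B\,s_1\,s_3)\,s_2$ for all $s_1,s_2,s_3$. Write "$s_1\approx s_2$ on $A$" for $A\,s_1\,s_2=s_1$. A scene space basis is a finite sequence of scenes $S_1,\dots,S_n$ with $S_i,S_j$ independent for $i\neq j$ and $S_1\sqcup\cdots\sqcup S_n=\top$; $\mathcal{B}=\{S_1,\dots,S_n\}$.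 For a set $X\subseteq\mathcal{B}$, $\bigcup X$ denotes the $\sqcup$ of all its elements (in any order, the result being independent of it), with $\bigcup\emptyset=\bot$. A program is a binary predicate $P(s,s')$ on $\mathcal{S}$. A formula is a Boolean-valued function on $\mathcal{S}$; conjunction of formulas is pointwise. $FV(F)=\{x\in\mathcal{B} : \exists s,s'.\ s\approx s' \text{ on } x^{\complement} \text{ and } F(s)\ne F(s')\}$. $BV(P)=\{x\in\mathcal{B} : \exists s_0,s_0'.\ P(s_0,s_0') \text{ and not } (s_0\approx s_0' \text{ on } x)\}$. Program $P$ does not interfere with formula $F$ if $BV(P)\cap FV(F)=\emptyset$. Box: $([P]F)(s)$ holds iff $F(s')$ holds for all $s'$ with $P(s,s')$. Parallel composition: $(P\parallel Q)(s,s')$ iff there exist $s_P,s_Q\in\mathcal{S}$ with $P(s,s_P)$, $Q(s,s_Q)$ and $s'=\mathrm{mrg}_{\bigcup BV(P)}\,s_Q\,s_P$. *)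

theory Defs
  imports "HOL-Library.Multiset"
begin

text \<open>The state space is the type \<open>'s\<close>. For a scene \<open>A\<close>, the state \<open>A x y\<close> is \<open>x\<close> with its
  \<open>A\<close>-part overwritten by that of \<open>y\<close>.\<close>

type_synonym 's scene = "'s \<Rightarrow> 's \<Rightarrow> 's"
type_synonym 's program = "'s \<Rightarrow> 's \<Rightarrow> bool"
type_synonym 's formula = "'s \<Rightarrow> bool"

definition is_scene :: "'s scene \<Rightarrow> bool" where
  "is_scene A \<longleftrightarrow>
     (\<forall>x y z. A (A x y) z = A x z) \<and> (\<forall>x y z. A x (A y z) = A x z) \<and> (\<forall>x. A x x = x)"

definition scene_bot :: "'s scene" where
  "scene_bot = (\<lambda>s1 s2. s1)"

definition scene_top :: "'s scene" where
  "scene_top = (\<lambda>s1 s2. s2)"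

definition scene_compl :: "'s scene \<Rightarrow> 's scene" where
  "scene_compl A = (\<lambda>s1 s2. A s2 s1)"

definition scene_join :: "'s scene \<Rightarrow> 's scene \<Rightarrow> 's scene" where
  "scene_join A B = (\<lambda>s1 s2. B (A s1 s2) s2)"

definition scene_indep :: "'s scene \<Rightarrow> 's scene \<Rightarrow> bool" where
  "scene_indep A B \<longleftrightarrow> (\<forall>s1 s2 s3. B (A s1 s2) s3 = A (B s1 s3) s2)"

definition scene_eq_on :: "'s scene \<Rightarrow> 's \<Rightarrow> 's \<Rightarrow> bool" where
  "scene_eq_on A s1 s2 \<longleftrightarrow> A s1 s2 = s1"

text \<open>\<open>scene_join\<close> is associative on the nose and has \<open>scene_bot\<close> as a unit, so bracketing and the
  start value do not matter.\<close>

definition scene_joins :: "'s scene list \<Rightarrow> 's scene" where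
  "scene_joins As = foldl scene_join scene_bot As"

text \<open>Independence is required of distinct positions, not merely of distinct entries.\<close>

definition scene_space_basis :: "'s scene list \<Rightarrow> bool" where
  "scene_space_basis Ss \<longleftrightarrow>
     (\<forall>A\<in>set Ss. is_scene A) \<and>
     (\<forall>i<length Ss. \<forall>j<length Ss. i \<noteq> j \<longrightarrow> scene_indep (Ss ! i) (Ss ! j)) \<and>
     scene_joins Ss = scene_top"

text \<open>The join of the elements of a finite set, enumerated in any order. The lemma
  \<open>scene_Union_set\<close> below shows that the description is proper on subsets of a basis.\<close>

definition scene_Union :: "'s scene set \<Rightarrow> 's scene" where
  "scene_Union X = (THE A. \<exists>xs. distinct xs \<and> set xs = X \<and> A = scene_joins xs)"

text \<open>In the following, \<open>B\<close> is the set of basis scenes.\<close>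

definition FV :: "'s scene set \<Rightarrow> 's formula \<Rightarrow> 's scene set" where
  "FV B F = {x \<in> B. \<exists>s s'. scene_eq_on (scene_compl x) s s' \<and> F s \<noteq> F s'}"

definition BV :: "'s scene set \<Rightarrow> 's program \<Rightarrow> 's scene set" where
  "BV B P = {x \<in> B. \<exists>s0 s0'. P s0 s0' \<and> \<not> scene_eq_on x s0 s0'}"

definition no_interference :: "'s scene set \<Rightarrow> 's program \<Rightarrow> 's formula \<Rightarrow> bool" where
  "no_interference B P F \<longleftrightarrow> BV B P \<inter> FV B F = {}"

definition box :: "'s program \<Rightarrow> 's formula \<Rightarrow> 's formula" where
  "box P F = (\<lambda>s. \<forall>s'. P s s' \<longrightarrow> F s')"

definition fconj :: "'s formula \<Rightarrow> 's formula \<Rightarrow> 's formula" where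
  "fconj F G = (\<lambda>s. F s \<and> G s)"

definition par :: "'s scene set \<Rightarrow> 's program \<Rightarrow> 's program \<Rightarrow> 's program" where
  "par B P Q = (\<lambda>s s'. \<exists>sP sQ. P s sP \<and> Q s sQ \<and> s' = scene_Union (BV B P) sQ sP)"

lemma scene_joins_apply: "scene_joins xs s1 s2 = fold (\<lambda>A s. A s s2) xs s1"
  by (induction xs rule: rev_induct) (simp_all add: scene_joins_def scene_bot_def scene_join_def)

lemma basis_indep:
  assumes "scene_space_basis Ss" "A \<in> set Ss" "B \<in> set Ss" "A \<noteq> B"
  shows "scene_indep A B"
  using assms unfolding scene_space_basis_def in_set_conv_nth by metis

lemma scene_joins_cong:
  assumes "scene_space_basis Ss" "set xs \<subseteq> set Ss" "distinct xs" "distinct ys" "set xs = set ys"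
  shows "scene_joins xs = scene_joins ys"
proof (intro ext)
  fix s1 s2
  have comm: "(\<lambda>s. A s s2) \<circ> (\<lambda>s. B s s2) = (\<lambda>s. B s s2) \<circ> (\<lambda>s. A s s2)"
    if "A \<in> set xs" "B \<in> set xs" for A B
  proof (cases "A = B")
    case False
    then have "scene_indep A B"
      using basis_indep assms(1,2) that by blast
    then show ?thesis
      by (simp add: scene_indep_def fun_eq_iff)
  qed simp
  have "mset xs = mset ys"
    using assms(3-5) set_eq_iff_mset_eq_distinct by blast
  then have "fold (\<lambda>A s. A s s2) xs = fold (\<lambda>A s. A s s2) ys"
    using comm by (intro fold_multiset_equiv) auto
  then show "scene_joins xs s1 s2 = scene_joins ys s1 s2"
    by (simp add: scene_joins_apply)
qed

lemma scene_Union_set: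
  assumes "scene_space_basis Ss" "set xs \<subseteq> set Ss" "distinct xs"
  shows "scene_Union (set xs) = scene_joins xs"
  unfolding scene_Union_def
proof (rule the_equality)
  show "\<exists>ys. distinct ys \<and> set ys = set xs \<and> scene_joins xs = scene_joins ys"
    using assms(3) by blast
next
  fix A assume "\<exists>ys. distinct ys \<and> set ys = set xs \<and> A = scene_joins ys"
  then show "A = scene_joins xs"
    using scene_joins_cong[OF assms] by metis
qed

end

theory Submission
  imports Defs
begin

text \<open>Suppose \<open>P\<close> and \<open>Q\<close> lead from \<open>s\<close> to \<open>sP\<close> and \<open>sQ\<close>, and let \<open>s'\<close> be the merged state.
  It arises from \<open>sQ\<close> by overwriting, one after the other, the scenes in \<open>BV P\<close>, none of which is
  free in \<open>F\<^sub>Q\<close>; so \<open>F\<^sub>Q\<close> is preserved. Since the basis covers the whole state, overwriting all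
  basis scenes of \<open>s'\<close> by those of \<open>sP\<close> yields \<open>sP\<close>. Here the scenes in \<open>BV P\<close> have no effect,
  because \<open>s'\<close> got them from \<open>sP\<close>; nor do those outside \<open>BV P\<close> and \<open>BV Q\<close>, on which \<open>sQ\<close> and
  \<open>sP\<close> both agree with \<open>s\<close>; and those in \<open>BV Q\<close> are not free in \<open>F\<^sub>P\<close>. Hence \<open>F\<^sub>P\<close> has the same
  value in \<open>s'\<close> as in \<open>sP\<close>.\<close>

lemma basis_is_scene:
  assumes "scene_space_basis Ss" "A \<in> set Ss"
  shows "is_scene A"
  using assms by (simp add: scene_space_basis_def)

lemma basis_commute:
  assumes "scene_space_basis Ss" "A \<in> set Ss" "B \<in> set Ss"
  shows "A (B u t) t = B (A u t) t"
  using basis_indep[OF assms] unfolding scene_indep_def by metis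

text \<open>Overwrites from a common source \<open>t\<close> commute, so none undoes an agreement
  with \<open>t\<close> on \<open>x\<close>.\<close>

lemma joins_keep_fixed:
  assumes "scene_space_basis Ss" "x \<in> set Ss" "set xs \<subseteq> set Ss" "x u t = u"
  shows "x (scene_joins xs u t) t = scene_joins xs u t"
  using assms(3,4)
proof (induction xs arbitrary: u)
  case (Cons a xs)
  then have "x (a u t) t = a u t"
    using basis_commute[OF assms(1,2), of a u t] by simp
  with Cons show ?case
    by (simp add: scene_joins_apply)
qed (simp add: scene_joins_apply)

lemma joins_absorb:
  assumes "scene_space_basis Ss" "set xs \<subseteq> set Ss" "x \<in> set xs"
  shows "x (scene_joins xs u t) t = scene_joins xs u t"
  using assms(2,3)
proof (induction xs arbitrary: u)
  case (Cons a xs)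
  show ?case
  proof (cases "x = a")
    case True
    then have "x (a u t) t = a u t"
      using basis_is_scene[OF assms(1), of a] Cons.prems by (simp add: is_scene_def)
    then show ?thesis
      using joins_keep_fixed[OF assms(1), of x xs "a u t" t] Cons.prems
      by (auto simp: scene_joins_apply)
  next
    case False
    then show ?thesis
      using Cons by (simp add: scene_joins_apply)
  qed
qed simp

lemma not_FV_overwrite:
  assumes "is_scene x" "x \<in> B" "x \<notin> FV B F"
  shows "F (x u t) = F u"
proof -
  have "scene_eq_on (scene_compl x) u (x u t)"
    using assms(1) by (simp add: scene_eq_on_def scene_compl_def is_scene_def)
  then show ?thesis
    using assms(2,3) by (auto simp: FV_def)
qed

text \<open>The second disjunct survives overwriting by other basis scenes, again by
  commutation.\<close>

lemma joins_preserve_formula: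
  assumes basis: "scene_space_basis Ss" and "set xs \<subseteq> set Ss"
    and "\<forall>x\<in>set xs. x \<notin> FV (set Ss) F \<or> x u t = u"
  shows "F (scene_joins xs u t) = F u"
  using assms(2,3)
proof (induction xs arbitrary: u)
  case (Cons a xs)
  have "F (a u t) = F u"
    using Cons.prems not_FV_overwrite[OF basis_is_scene[OF basis, of a], of "set Ss" F u t] by auto
  moreover have "\<forall>x\<in>set xs. x \<notin> FV (set Ss) F \<or> x (a u t) t = a u t"
    using Cons.prems basis_commute[OF basis] by (metis list.set_intros subsetD)
  ultimately show ?case
    using Cons by (simp add: scene_joins_apply)
qed (simp add: scene_joins_apply)

text \<open>\<open>x u\<close> sees only the \<open>x\<close>-part of its argument, which
  \<open>t\<close> and \<open>u\<close> share via \<open>s\<close>.\<close>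

lemma agree_via:
  assumes "is_scene x" "scene_eq_on x s t" "scene_eq_on x s u"
  shows "x u t = u"
proof -
  have "x u t = x u (x s t)"
    using assms(1) by (simp add: is_scene_def)
  also have "\<dots> = x u (x s u)"
    using assms(2,3) by (simp add: scene_eq_on_def)
  also have "\<dots> = u"
    using assms(1) by (simp add: is_scene_def)
  finally show ?thesis .
qed

theorem theorem49:
  fixes Ss :: "'s scene list"
    and P Q :: "'s program"
    and F\<^sub>P F\<^sub>Q :: "'s formula"
  assumes "scene_space_basis Ss"
    and "no_interference (set Ss) P F\<^sub>Q"
    and "no_interference (set Ss) Q F\<^sub>P"
  shows "\<forall>s. fconj (box P F\<^sub>P) (box Q F\<^sub>Q) s \<longrightarrow> box (par (set Ss) P Q) (fconj F\<^sub>P F\<^sub>Q) s"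
proof (intro allI impI)
  fix s
  assume boxes: "fconj (box P F\<^sub>P) (box Q F\<^sub>Q) s"
  \<comment> \<open>A repetition-free enumeration turns the union into successive
    overwrites.\<close>
  have "finite (BV (set Ss) P)"
    by (simp add: BV_def)
  from finite_distinct_list[OF this]
  obtain xs where xs: "set xs = BV (set Ss) P" "distinct xs"
    by blast
  then have sub: "set xs \<subseteq> set Ss"
    by (auto simp: BV_def)
  have Union: "scene_Union (BV (set Ss) P) = scene_joins xs"
    using scene_Union_set[OF assms(1) sub xs(2)] xs(1) by simp
  show "box (par (set Ss) P Q) (fconj F\<^sub>P F\<^sub>Q) s"
    unfolding box_def
  proof (intro allI impI)
    fix s'
    assume "par (set Ss) P Q s s'"
    then obtain sP sQ where P: "P s sP" and Q: "Q s sQ" and s': "s' = scene_joins xs sQ sP"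
      by (auto simp: par_def Union)
    have "F\<^sub>P sP" "F\<^sub>Q sQ"
      using boxes P Q by (auto simp: fconj_def box_def)
    have "F\<^sub>Q s' = F\<^sub>Q sQ"
      unfolding s' using assms(2) xs(1)
      by (intro joins_preserve_formula[OF assms(1) sub]) (auto simp: no_interference_def)
    moreover have "F\<^sub>P (scene_joins Ss s' sP) = F\<^sub>P s'"
    proof (intro joins_preserve_formula[OF assms(1) order_refl] ballI)
      fix x
      assume x: "x \<in> set Ss"
      consider "x \<in> BV (set Ss) P" | "x \<in> BV (set Ss) Q"
        | "x \<notin> BV (set Ss) P" "x \<notin> BV (set Ss) Q"
        by blast
      then show "x \<notin> FV (set Ss) F\<^sub>P \<or> x s' sP = s'"
      proof cases
        case 1
        then show ?thesis
          using joins_absorb[OF assms(1) sub] xs(1) s' by simp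
      next
        case 2
        then show ?thesis
          using assms(3) by (auto simp: no_interference_def)
      next
        case 3
        then have "scene_eq_on x s sP" "scene_eq_on x s sQ"
          using P Q x by (auto simp: BV_def)
        then have "x sQ sP = sQ"
          by (rule agree_via[OF basis_is_scene[OF assms(1) x]])
        then show ?thesis
          using joins_keep_fixed[OF assms(1) x sub] s' by simp
      qed
    qed
    moreover have "scene_joins Ss s' sP = sP"
      using assms(1) by (simp add: scene_space_basis_def scene_top_def)
    ultimately show "fconj F\<^sub>P F\<^sub>Q s'"
      using \<open>F\<^sub>P sP\<close> \<open>F\<^sub>Q sQ\<close> by (simp add: fconj_def)
  qed
qed

end
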